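(* Let $m\ge2$, let $C_1,\dots,C_m$ be closed convex subsets of a Euclidean space $X$, $I=\{1,\dots,m\}$, and suppose that $\bigcap_{i\in I_p}C_i\cap\bigcap_{i\in I\setminus I_p}\mathrm{ri}\,C_i\ne\varnothing$, where $I_p:=\{i\in I: C_i\text{ is polyhedral}\}$. Suppose also that each $C_i$ is $\tau_i$-injectable for some $\tau_i\ge0$. Let $\alpha_i\in[0,1]$ for every $i\in I$ and assume there is at most one $\alpha_j$ equal to $1$. Then, regardless of the starting point, every cyclic semi-intrepid projection sequence generated by $(P_{C_i}^{(\alpha_i,\tau_i)})_{i\in I}$ converges $R$-linearly to a point $\bar x\in C:=\bigcap_{i\in I}C_i$. In particular, for every starting point $x_0\in X$, the linear rate is $$\rho:=\left[1-\frac{1}{\kappa^2}\Big(\Big(\sum_{i\in I\setminus J}\frac{1+\alpha_i}{1-\alpha_i}\Big)-(1-|J|)\min_{i\in I\setminus J}\frac{1+\alpha_i}{1-\alpha_i}\Big)^{-1}\right]_+^{\frac{1}{2(m-1+|J|)}},$$ where $J:=\{i\in I:\alpha_i=1\}$ and $\kappa>0$ is a linear regularity modulus of $\{C_i\}_{i\in I}$ on $\mathbb{B}(w;\delta/2)$ for some $\delta>0$ satisfying $\delta\ge2d_C(x_0)$ and some $w\in C$ satisfying $\delta\ge2\|x_0-w\|$.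
   Context: $X$ is a Euclidean space with norm $\|\cdot\|$. $\mathbb{B}(w;\rho)$ is the closed ball with center $w$ and radius $\rho$. $\mathrm{ri}$ denotes relative interior. $[t]_+:=\max\{0,t\}$; $|J|$ is the number of elements of $J$. For a nonempty closed set $C$: $d_C(x)=\inf_{c\in C}\|x-c\|$ and $P_Cx=\{c\in C:\|x-c\|=d_C(x)\}$ (a singleton for convex $C$). Injectability: a nonempty closed set $C$ is $\tau$-injectable ($\tau\ge0$) if for all $x\in X$ and $p\in P_Cx$, the segment $\big[p,\,p+\tau\frac{p-x}{\|p-x\|}\big]$ is contained in $C$, with the convention $\frac{p-x}{\|p-x\|}=0$ if $p=x$. Semi-intrepid projector: for $\alpha\in[0,1]$, $\tau\ge0$ and a $\tau$-injectable set $C$, $P_C^{(\alpha,\tau)}x:=\big\{p+(p-x)\min\{\alpha,\tfrac{\tau}{\|p-x\|}\}: p\in P_Cx\big\}$ for $x\in X$, with the convention $\frac{\tau}{\|p-x\|}=0$ if $p=x$. Cyclic sequences: for set-valued operators $T_1,\dots,T_m$ on $X$, put $T_{mn+i}:=T_i$ for $n\in\mathbb{N}$, $i\in I$; a cyclic sequence generated by $(T_i)_{i\in I}$ is any sequence with $x_0\in X$ and $x_{n+1}\in T_{n+1}x_n$ for all $n\in\mathbb{N}=\{0,1,2,\dots\}$. $R$-linear convergence: $(x_n)$ converges $R$-linearly to $\bar x$ with rate $\rho\in[0,1)$ if there is $\sigma\ge0$ with $\|x_n-\bar x\|\le\sigma\rho^n$ for all $n\in\mathbb{N}$; it converges $R$-linearly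 if this holds for some rate $\rho\in[0,1)$. Linear regularity: $\kappa>0$ is a linear regularity modulus of $\{C_i\}_{i\in I}$ on $U\subseteq X$ if $d_C(x)\le\kappa\max_{i\in I}d_{C_i}(x)$ for all $x\in U$, where $C=\bigcap_{i\in I}C_i$.
   Formalization: When ρ=0 the claimed rate fails as stated (X=ℝ, C_1=ℝ, C_2={0}, α_i=τ_i=0, x_0=1, κ=1 gives x_1≠x̄); in that case the formal theorem states instead that x_n = x̄ for all n ≥ 2m−1. *)

theory Defs
  imports "HOL-Analysis.Analysis"
begin

definition proj :: "'a::euclidean_space set \<Rightarrow> 'a \<Rightarrow> 'a set" where
  "proj C x = {c \<in> C. norm (x - c) = infdist x C}"

(* Here and in semi_intrepid_proj, Isabelle's totalised division by zero coincides with the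
   conventions (p - x)/|p - x| = 0 and \<tau>/|p - x| = 0 for p = x. *)
definition injectable :: "real \<Rightarrow> 'a::euclidean_space set \<Rightarrow> bool" where
  "injectable \<tau> C \<longleftrightarrow> 0 \<le> \<tau> \<and> closed C \<and> C \<noteq> {} \<and>
     (\<forall>x. \<forall>p \<in> proj C x. closed_segment p (p + \<tau> *\<^sub>R ((p - x) /\<^sub>R norm (p - x))) \<subseteq> C)"

definition semi_intrepid_proj ::
    "'a::euclidean_space set \<Rightarrow> real \<Rightarrow> real \<Rightarrow> 'a \<Rightarrow> 'a set" where
  "semi_intrepid_proj C \<alpha> \<tau> x =
     {p + min \<alpha> (\<tau> / norm (p - x)) *\<^sub>R (p - x) | p. p \<in> proj C x}"

(* The operators are T 1, ..., T m, extended m-periodically, so that T_(n+1) is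
   T (n mod m + 1). *)
definition cyclic_sequence :: "nat \<Rightarrow> (nat \<Rightarrow> 'a \<Rightarrow> 'a set) \<Rightarrow> (nat \<Rightarrow> 'a) \<Rightarrow> bool" where
  "cyclic_sequence m T x \<longleftrightarrow> (\<forall>n. x (Suc n) \<in> T (n mod m + 1) (x n))"

definition R_linear_rate ::
    "(nat \<Rightarrow> 'a::real_normed_vector) \<Rightarrow> 'a \<Rightarrow> real \<Rightarrow> bool" where
  "R_linear_rate x l \<rho> \<longleftrightarrow>
     0 \<le> \<rho> \<and> \<rho> < 1 \<and> (\<exists>\<sigma>\<ge>0. \<forall>n. norm (x n - l) \<le> \<sigma> * \<rho> ^ n)"

definition R_linearly_convergent ::
    "(nat \<Rightarrow> 'a::real_normed_vector) \<Rightarrow> 'a \<Rightarrow> bool" where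
  "R_linearly_convergent x l \<longleftrightarrow> (\<exists>\<rho>. R_linear_rate x l \<rho>)"

definition linear_regularity_modulus ::
    "nat set \<Rightarrow> (nat \<Rightarrow> 'a::euclidean_space set) \<Rightarrow> 'a set \<Rightarrow> real \<Rightarrow> bool" where
  "linear_regularity_modulus I C U \<kappa> \<longleftrightarrow> 0 < \<kappa> \<and>
     (\<forall>x\<in>U. infdist x (\<Inter>i\<in>I. C i) \<le> \<kappa> * Max ((\<lambda>i. infdist x (C i)) ` I))"

definition regularity_modulus_for_start ::
    "nat set \<Rightarrow> (nat \<Rightarrow> 'a::euclidean_space set) \<Rightarrow> 'a \<Rightarrow> real \<Rightarrow> bool" where
  "regularity_modulus_for_start I C x0 \<kappa> \<longleftrightarrow>
     (\<exists>\<delta> w. 0 < \<delta> \<and> 2 * infdist x0 (\<Inter>i\<in>I. C i) \<le> \<delta> \<and>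
        w \<in> (\<Inter>i\<in>I. C i) \<and> 2 * norm (x0 - w) \<le> \<delta> \<and>
        linear_regularity_modulus I C (cball w (\<delta> / 2)) \<kappa>)"

(* The value may be 0.  The bound R_linear_rate x l 0 forces x n = l for all n \<ge> 1, which
   can fail for genuine semi-intrepid sequences: with C_1 = UNIV, C_2 = {0}, \<alpha> = \<tau> = 0,
   x 0 \<noteq> 0 and \<kappa> = 1 the value is 0, but x 1 = x 0.  What holds in that case is
   finite termination. *)
definition semi_intrepid_rate :: "nat \<Rightarrow> (nat \<Rightarrow> real) \<Rightarrow> real \<Rightarrow> real" where
  "semi_intrepid_rate m \<alpha> \<kappa> =
     (let I = {1..m};
          J = {i \<in> I. \<alpha> i = 1};
          q = (\<lambda>i. (1 + \<alpha> i) / (1 - \<alpha> i))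
      in max 0 (1 - 1 / \<kappa>\<^sup>2 *
           inverse ((\<Sum>i\<in>I - J. q i) - (1 - real (card J)) * Min (q ` (I - J))))
         powr (1 / (2 * (real m - 1 + real (card J)))))"

end

theory Submission
  imports Defs
begin

text \<open>Let \<open>y\<close> be a semi-intrepid projection of \<open>x\<close> onto \<open>C i\<close>.  Then \<open>y\<close> lies in \<open>C i\<close> by
  injectability, and the relaxation estimate
  \<open>\<parallel>y - c\<parallel>\<^sup>2 \<le> \<parallel>x - c\<parallel>\<^sup>2 - (1 - \<alpha> i) / (1 + \<alpha> i) * \<parallel>y - x\<parallel>\<^sup>2\<close> holds for all \<open>c\<close> in \<open>C i\<close>.  From an
  iterate that lies in one of the sets, the next \<open>m - 1\<close> steps visit all the others; by the
  Cauchy-Schwarz inequality, the squared steps control the squared distance to each \<open>C i\<close>, hence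
  by linear regularity the squared distance to the intersection, which therefore contracts by
  a fixed factor.  If some \<open>\<alpha> j\<close> is 1, the step onto \<open>C j\<close> gives no decrease, so the blocks
  start right after it and have length \<open>m\<close>.  Fejer monotonicity turns the decay of the distance
  into \<open>R\<close>-linear convergence.  Linear regularity on bounded sets follows from a Hoffman bound.\<close>

subsection \<open>Bounded linear regularity\<close>

text \<open>A common vector \<open>u\<close> of the cone \<open>K\<close> and its polar satisfies
  \<open>u \<bullet> u \<le> 0\<close>, so \<open>f\<close> is positive on the compact set
  \<open>S\<close> of unit vectors of the polar. Its minimum there is \<open>c\<close>, and positive
  homogeneity of \<open>f\<close> covers the other vectors.\<close>

lemma polar_cone_bound:
  fixes a :: "'k \<Rightarrow> 'a::euclidean_space"
  assumes "finite A"
  obtains c where "c > 0"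
    "\<And>u. (\<And>v. (\<And>k. k \<in> A \<Longrightarrow> a k \<bullet> v \<le> 0) \<Longrightarrow> u \<bullet> v \<le> 0)
       \<Longrightarrow> c * norm u \<le> (\<Sum>k\<in>A. max 0 (a k \<bullet> u))"
proof -
  define f where "f = (\<lambda>u. \<Sum>k\<in>A. max 0 (a k \<bullet> u))"
  define K where "K = {v. \<forall>k\<in>A. a k \<bullet> v \<le> 0}"
  define S where "S = sphere 0 1 \<inter> (\<Inter>v\<in>K. {u. u \<bullet> v \<le> 0})"
  have "compact S"
    unfolding S_def
    by (intro compact_Int_closed closed_INT ballI)
       (auto intro!: closed_Collect_le continuous_intros)
  have cont: "continuous_on S f"
    unfolding f_def by (intro continuous_intros)
  have pos: "f u > 0" if "u \<in> S" for u
  proof (rule ccontr)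
    assume "\<not> f u > 0"
    moreover have "f u \<ge> 0" unfolding f_def by (intro sum_nonneg) auto
    ultimately have "f u = 0" by simp
    then have "\<forall>k\<in>A. max 0 (a k \<bullet> u) = 0"
      unfolding f_def using sum_nonneg_eq_0_iff[OF assms, of "\<lambda>k. max 0 (a k \<bullet> u)"] by simp
    then have "u \<in> K" unfolding K_def by (auto simp: max_def split: if_splits)
    then have "u \<bullet> u \<le> 0" using that by (auto simp: S_def)
    then have "u = 0" using inner_gt_zero_iff[of u] by linarith
    then show False using that by (simp add: S_def)
  qed
  obtain c where c: "c > 0" "\<And>u. u \<in> S \<Longrightarrow> c \<le> f u"
  proof (cases "S = {}")
    case True
    then show ?thesis using that[of 1] by simp
  next
    case False
    then obtain u0 where "u0 \<in> S" "\<forall>u\<in>S. f u0 \<le> f u"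
      using continuous_attains_inf[OF \<open>compact S\<close> _ cont] by blast
    then show ?thesis using that pos by blast
  qed
  have "c * norm u \<le> f u" if "\<And>v. (\<And>k. k \<in> A \<Longrightarrow> a k \<bullet> v \<le> 0) \<Longrightarrow> u \<bullet> v \<le> 0" for u
  proof (cases "u = 0")
    case True
    then show ?thesis by (simp add: f_def)
  next
    case False
    define w where "w = u /\<^sub>R norm u"
    have "w \<bullet> v \<le> 0" if "v \<in> K" for v
      using that \<open>\<And>v. (\<And>k. k \<in> A \<Longrightarrow> a k \<bullet> v \<le> 0) \<Longrightarrow> u \<bullet> v \<le> 0\<close>[of v]
      by (auto simp: w_def K_def inner_scaleR_left intro: mult_nonneg_nonpos)
    then have "w \<in> S" using False by (auto simp: S_def w_def)
    then have "c \<le> f w" by (rule c)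
    also have "f w = f u / norm u"
      unfolding f_def sum_divide_distrib
    proof (intro sum.cong refl)
      fix k
      have "a k \<bullet> w = (a k \<bullet> u) / norm u" by (simp add: w_def field_simps)
      then show "max 0 (a k \<bullet> w) = max 0 (a k \<bullet> u) / norm u"
        using False by (auto simp: max_def zero_le_divide_iff divide_le_0_iff)
    qed
    finally show ?thesis using False by (simp add: field_simps)
  qed
  then show ?thesis using that c(1) unfolding f_def by blast
qed

text \<open>If \<open>p\<close> is the projection of \<open>x\<close>, then \<open>x - p\<close> lies in the polar of the cone cut out by
  the constraints active at \<open>p\<close>.  There are only finitely many such cones, so the compactness
  constants of \<open>polar_cone_bound\<close> have a common bound.\<close>
lemma hoffman_bound:
  fixes a :: "'k \<Rightarrow> 'a::euclidean_space"
  assumes "finite K" and ne: "{y. \<forall>k\<in>K. a k \<bullet> y \<le> b k} \<noteq> {}"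
  obtains \<kappa> where "\<kappa> \<ge> 0"
    "\<And>x. infdist x {y. \<forall>k\<in>K. a k \<bullet> y \<le> b k} \<le> \<kappa> * (\<Sum>k\<in>K. max 0 (a k \<bullet> x - b k))"
proof -
  define P where "P = {y. \<forall>k\<in>K. a k \<bullet> y \<le> b k}"
  have P_alt: "P = (\<Inter>k\<in>K. {y. a k \<bullet> y \<le> b k})" by (auto simp: P_def)
  have "closed P" "convex P"
    unfolding P_alt by (auto intro!: closed_INT convex_INT closed_halfspace_le convex_halfspace_le)
  have "\<exists>c>0. \<forall>u. (\<forall>v. (\<forall>k\<in>A. a k \<bullet> v \<le> 0) \<longrightarrow> u \<bullet> v \<le> 0)
          \<longrightarrow> c * norm u \<le> (\<Sum>k\<in>A. max 0 (a k \<bullet> u))" if "A \<in> Pow K" for A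
    using polar_cone_bound[of A a] that assms(1) by (metis PowD finite_subset)
  then obtain c where c: "\<And>A. A \<in> Pow K \<Longrightarrow> c A > 0"
    "\<And>A u. A \<in> Pow K \<Longrightarrow> (\<forall>v. (\<forall>k\<in>A. a k \<bullet> v \<le> 0) \<longrightarrow> u \<bullet> v \<le> 0)
          \<Longrightarrow> c A * norm u \<le> (\<Sum>k\<in>A. max 0 (a k \<bullet> u))"
    by metis
  \<comment> \<open>The active set depends on \<open>x\<close>; the sum over all subsets of
    \<open>K\<close> dominates \<open>1 / c A\<close> for each of them.\<close>
  define \<kappa> where "\<kappa> = (\<Sum>A\<in>Pow K. 1 / c A)"
  have "\<kappa> \<ge> 0" unfolding \<kappa>_def using c(1) by (intro sum_nonneg) (simp add: less_imp_le)
  moreover have "infdist x P \<le> \<kappa> * (\<Sum>k\<in>K. max 0 (a k \<bullet> x - b k))" for x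
  proof -
    obtain p where p: "p \<in> P" "\<And>y. y \<in> P \<Longrightarrow> dist x p \<le> dist x y"
      using distance_attains_inf[OF \<open>closed P\<close>, of x] ne P_def by blast
    define A where "A = {k \<in> K. a k \<bullet> p = b k}"
    have A: "A \<in> Pow K" by (auto simp: A_def)
    have polar: "(x - p) \<bullet> v \<le> 0" if v: "\<forall>k\<in>A. a k \<bullet> v \<le> 0" for v
    proof -
      \<comment> \<open>A short step from \<open>p\<close> along \<open>v\<close> stays in
        \<open>P\<close>: active constraints do not increase along \<open>v\<close>, inactive ones
        have slack. The obtuse angle property of the projection \<open>p\<close> then gives the
        claim.\<close>
      have "\<exists>t>0. \<forall>k\<in>K. a k \<bullet> (p + t *\<^sub>R v) \<le> b k"
      proof -
        have "\<forall>k\<in>K. eventually (\<lambda>t. a k \<bullet> (p + t *\<^sub>R v) \<le> b k) (at_right 0)"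
        proof
          fix k assume k: "k \<in> K"
          show "eventually (\<lambda>t. a k \<bullet> (p + t *\<^sub>R v) \<le> b k) (at_right 0)"
          proof (cases "k \<in> A")
            case True
            then have "a k \<bullet> p = b k" "a k \<bullet> v \<le> 0" using v by (auto simp: A_def)
            then have "\<And>t. t > 0 \<Longrightarrow> a k \<bullet> (p + t *\<^sub>R v) \<le> b k"
              by (simp add: inner_add_right mult_nonneg_nonpos)
            then show ?thesis by (simp add: eventually_at_filter)
          next
            case False
            then have "a k \<bullet> p < b k" using k p(1) by (auto simp: A_def P_def less_le)
            moreover have "((\<lambda>t. a k \<bullet> (p + t *\<^sub>R v)) \<longlongrightarrow> a k \<bullet> (p + 0 *\<^sub>R v)) (at_right 0)"
              by (intro tendsto_intros)
            ultimately have "eventually (\<lambda>t. a k \<bullet> (p + t *\<^sub>R v) < b k) (at_right 0)"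
              by (intro order_tendstoD) auto
            then show ?thesis by (rule eventually_mono) simp
          qed
        qed
        then have "eventually (\<lambda>t. \<forall>k\<in>K. a k \<bullet> (p + t *\<^sub>R v) \<le> b k) (at_right 0)"
          using assms(1) by (simp add: eventually_ball_finite)
        moreover have "eventually (\<lambda>t::real. t > 0) (at_right 0)"
          by (simp add: eventually_at_filter)
        ultimately have "eventually (\<lambda>t. t > 0 \<and> (\<forall>k\<in>K. a k \<bullet> (p + t *\<^sub>R v) \<le> b k)) (at_right 0)"
          by eventually_elim simp
        then show ?thesis by (metis (lifting) eventually_happens trivial_limit_at_right_real)
      qed
      then obtain t where t: "t > 0" "p + t *\<^sub>R v \<in> P" by (auto simp: P_def)
      then have "(x - p) \<bullet> (p + t *\<^sub>R v - p) \<le> 0"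
        using any_closest_point_dot[OF \<open>convex P\<close> \<open>closed P\<close> p(1)] p(2) by blast
      then show ?thesis using t(1) by (simp add: mult_le_0_iff)
    qed
    have "infdist x P \<le> norm (x - p)" using infdist_le[OF p(1), of x] by (simp add: dist_norm)
    also have "\<dots> = 1 / c A * (c A * norm (x - p))" using c(1)[OF A] by simp
    also have "\<dots> \<le> 1 / c A * (\<Sum>k\<in>A. max 0 (a k \<bullet> (x - p)))"
      using c(1)[OF A] polar by (intro mult_left_mono c(2)[OF A]) (auto simp: less_imp_le)
    also have "(\<Sum>k\<in>A. max 0 (a k \<bullet> (x - p))) = (\<Sum>k\<in>A. max 0 (a k \<bullet> x - b k))"
      by (intro sum.cong) (auto simp: A_def inner_diff_right)
    also have "1 / c A * \<dots> \<le> \<kappa> * (\<Sum>k\<in>K. max 0 (a k \<bullet> x - b k))"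
    proof (rule mult_mono)
      show "1 / c A \<le> \<kappa>"
        unfolding \<kappa>_def using A assms(1) c(1)
        by (intro member_le_sum) (auto simp: less_imp_le)
      show "(\<Sum>k\<in>A. max 0 (a k \<bullet> x - b k)) \<le> (\<Sum>k\<in>K. max 0 (a k \<bullet> x - b k))"
        using assms(1) by (intro sum_mono2) (auto simp: A_def)
    qed (use \<open>\<kappa> \<ge> 0\<close> in \<open>auto intro: sum_nonneg\<close>)
    finally show ?thesis .
  qed
  ultimately show ?thesis using that unfolding P_def by blast
qed

text \<open>\<open>hoffman_bound\<close> is applied jointly to all halfspaces that define the sets.
  A halfspace containing \<open>C i\<close> is violated at \<open>x\<close> by at most the norm of
  its normal times the distance from \<open>x\<close> to \<open>C i\<close>. The free bound
  \<open>M\<close> may later come from distances to subsets of the polyhedra.\<close>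

lemma polyhedra_linearly_regular:
  fixes C :: "'i \<Rightarrow> 'a::euclidean_space set"
  assumes "finite I" "\<And>i. i \<in> I \<Longrightarrow> polyhedron (C i)" and ne: "(\<Inter>i\<in>I. C i) \<noteq> {}"
  obtains \<kappa> where "\<kappa> \<ge> 0"
    "\<And>x M. 0 \<le> M \<Longrightarrow> (\<And>i. i \<in> I \<Longrightarrow> infdist x (C i) \<le> M) \<Longrightarrow> infdist x (\<Inter>i\<in>I. C i) \<le> \<kappa> * M"
proof -
  have "\<forall>i\<in>I. \<exists>F. finite F \<and> C i = \<Inter>F \<and> (\<forall>h\<in>F. \<exists>a b. a \<noteq> 0 \<and> h = {x. a \<bullet> x \<le> b})"
    using assms(2) unfolding polyhedron_def by blast
  then obtain F where F: "\<And>i. i \<in> I \<Longrightarrow> finite (F i)" "\<And>i. i \<in> I \<Longrightarrow> C i = \<Inter>(F i)"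
    "\<And>i h. i \<in> I \<Longrightarrow> h \<in> F i \<Longrightarrow> \<exists>a b. h = {x. a \<bullet> x \<le> b}"
    by metis
  \<comment> \<open>The halfspaces serve as their own indices.\<close>
  define K where "K = (\<Union>i\<in>I. F i)"
  have "finite K" using assms(1) F(1) by (simp add: K_def)
  have "\<forall>h\<in>K. \<exists>a b. h = {x. a \<bullet> x \<le> b}" using F(3) by (auto simp: K_def)
  then obtain a b where ab: "\<And>h. h \<in> K \<Longrightarrow> h = {x. a h \<bullet> x \<le> b h}" by metis
  have eq: "(\<Inter>i\<in>I. C i) = {y. \<forall>h\<in>K. a h \<bullet> y \<le> b h}"
  proof -
    have "(\<Inter>i\<in>I. C i) = \<Inter>K" using F(2) by (auto simp: K_def)
    also have "\<dots> = {y. \<forall>h\<in>K. a h \<bullet> y \<le> b h}" using ab by blast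
    finally show ?thesis .
  qed
  obtain \<kappa> where \<kappa>: "\<kappa> \<ge> 0"
    "\<And>x. infdist x (\<Inter>i\<in>I. C i) \<le> \<kappa> * (\<Sum>h\<in>K. max 0 (a h \<bullet> x - b h))"
    by (rule hoffman_bound[OF \<open>finite K\<close>, of a b]) (use ne eq in auto)
  have "infdist x (\<Inter>i\<in>I. C i) \<le> (\<kappa> * (\<Sum>h\<in>K. norm (a h))) * M"
    if "0 \<le> M" "\<And>i. i \<in> I \<Longrightarrow> infdist x (C i) \<le> M" for x M
  proof -
    have "max 0 (a h \<bullet> x - b h) \<le> norm (a h) * M" if h: "h \<in> K" for h
    proof -
      obtain i where i: "i \<in> I" "h \<in> F i" using h by (auto simp: K_def)
      have "closed (C i)" "C i \<noteq> {}"
        using polyhedron_imp_closed assms(2) i ne by auto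
      then obtain c where c: "c \<in> C i" "infdist x (C i) = dist x c"
        using infdist_attains_inf by metis
      have "c \<in> h" using c(1) F(2) i by auto
      then have "a h \<bullet> c \<le> b h" using ab[OF h] by blast
      then have "a h \<bullet> x - b h \<le> a h \<bullet> (x - c)" by (simp add: inner_diff_right)
      also have "\<dots> \<le> norm (a h) * norm (x - c)" by (rule norm_cauchy_schwarz)
      also have "\<dots> \<le> norm (a h) * M"
        using that(1) \<open>\<And>i. i \<in> I \<Longrightarrow> infdist x (C i) \<le> M\<close>[OF i(1)] c(2)
        by (intro mult_left_mono) (auto simp: dist_norm)
      finally show ?thesis using \<open>0 \<le> M\<close> by simp
    qed
    then have "(\<Sum>h\<in>K. max 0 (a h \<bullet> x - b h)) \<le> (\<Sum>h\<in>K. norm (a h)) * M"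
      unfolding sum_distrib_right by (rule sum_mono)
    then show ?thesis using \<kappa>(2)[of x] \<kappa>(1)
      by (smt (verit) mult.assoc mult_left_mono)
  qed
  moreover have "\<kappa> * (\<Sum>h\<in>K. norm (a h)) \<ge> 0" using \<kappa>(1) by (simp add: sum_nonneg)
  ultimately show ?thesis using that by blast
qed

text \<open>Replacing each non-polyhedral set by its affine hull leaves polyhedra, to which the
  previous lemma applies; the projection onto their intersection is then moved towards the
  Slater point \<open>z\<close> until it enters every \<open>C i\<close>.\<close>
lemma boundedly_linearly_regular:
  fixes C :: "'i \<Rightarrow> 'a::euclidean_space set"
  assumes "finite I" "I \<noteq> {}"
    and cl: "\<And>i. i \<in> I \<Longrightarrow> closed (C i)" and cv: "\<And>i. i \<in> I \<Longrightarrow> convex (C i)"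
    and z: "\<And>i. i \<in> I \<Longrightarrow> z \<in> C i"
    and z': "\<And>i. i \<in> I \<Longrightarrow> \<not> polyhedron (C i) \<Longrightarrow> z \<in> rel_interior (C i)"
    and "bounded U"
  obtains \<kappa> where "\<kappa> > 0"
    "\<And>x. x \<in> U \<Longrightarrow> infdist x (\<Inter>i\<in>I. C i) \<le> \<kappa> * Max ((\<lambda>i. infdist x (C i)) ` I)"
proof -
  define D where "D i = (if polyhedron (C i) then C i else affine hull (C i))" for i
  define L where "L = (\<Inter>i\<in>I. D i)"
  have CD: "C i \<subseteq> D i" for i by (simp add: D_def hull_subset)
  have polyD: "polyhedron (D i)" for i
    by (auto simp: D_def affine_imp_polyhedron affine_affine_hull)
  have zL: "z \<in> L" using z CD by (auto simp: L_def)
  have "closed L" "convex L"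
    unfolding L_def using polyD polyhedron_imp_closed polyhedron_imp_convex
    by (blast intro: closed_INT convex_INT)+
  obtain \<kappa> where \<kappa>: "\<kappa> \<ge> 0"
    "\<And>x M. 0 \<le> M \<Longrightarrow> (\<And>i. i \<in> I \<Longrightarrow> infdist x (D i) \<le> M) \<Longrightarrow> infdist x L \<le> \<kappa> * M"
    unfolding L_def
    by (rule polyhedra_linearly_regular[OF assms(1), of D]) (use polyD zL in \<open>auto simp: L_def\<close>)
  have "\<exists>e>0. \<not> polyhedron (C i) \<longrightarrow> ball z e \<inter> affine hull (C i) \<subseteq> C i" if "i \<in> I" for i
    using z'[OF that] by (cases "polyhedron (C i)") (auto simp: mem_rel_interior_ball intro: exI[of _ 1])
  then obtain e where e: "\<And>i. i \<in> I \<Longrightarrow> e i > 0"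
    "\<And>i. i \<in> I \<Longrightarrow> \<not> polyhedron (C i) \<Longrightarrow> ball z (e i) \<inter> affine hull (C i) \<subseteq> C i"
    by metis
  \<comment> \<open>Half the least radius, so that \<open>norm (y - z) \<le> \<epsilon>\<close> puts
    \<open>y\<close> strictly inside each ball.\<close>
  define \<epsilon> where "\<epsilon> = Min (e ` I) / 2"
  have "Min (e ` I) > 0" using assms(1,2) e(1) by simp
  then have "\<epsilon> > 0" by (simp add: \<epsilon>_def)
  have ri: "y \<in> C i"
    if "i \<in> I" "\<not> polyhedron (C i)" "y \<in> affine hull (C i)" "norm (y - z) \<le> \<epsilon>" for i y
  proof -
    have "Min (e ` I) \<le> e i" using assms(1) that(1) by simp
    then have "norm (y - z) < e i" using that(4) \<open>Min (e ` I) > 0\<close> by (simp add: \<epsilon>_def)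
    then show ?thesis using e(2)[OF that(1,2)] that(3)
      by (auto simp: dist_norm norm_minus_commute)
  qed
  obtain R where R: "R > 0" "\<And>x. x \<in> U \<Longrightarrow> norm (x - z) \<le> R"
  proof -
    obtain r where "\<forall>x\<in>U. dist z x \<le> r" using \<open>bounded U\<close> bounded_any_center[of U z] by blast
    then show ?thesis using that[of "max 1 r"] by (auto simp: dist_norm norm_minus_commute le_max_iff_disj less_max_iff_disj)
  qed
  \<comment> \<open>\<open>\<kappa>\<close> accounts for the way from \<open>x\<close> to its
    projection \<open>y\<close> on \<open>L\<close>, and
    \<open>(1 + \<kappa>) * R / \<epsilon>\<close> for the shift from \<open>y\<close> to
    \<open>u\<close>; the summand 1 makes the modulus positive.\<close>
  have "infdist x (\<Inter>i\<in>I. C i) \<le> (1 + \<kappa> + (1 + \<kappa>) * R / \<epsilon>) * Max ((\<lambda>i. infdist x (C i)) ` I)"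
    if "x \<in> U" for x
  proof -
    define M where "M = Max ((\<lambda>i. infdist x (C i)) ` I)"
    have M: "infdist x (C i) \<le> M" if "i \<in> I" for i using that assms(1) by (simp add: M_def)
    have "M \<ge> 0" using M assms(2) infdist_nonneg by (metis ex_in_conv order_trans)
    obtain y where y: "y \<in> L" "infdist x L = dist x y"
      using infdist_attains_inf[OF \<open>closed L\<close>] zL by blast
    have "infdist x (D i) \<le> M" if "i \<in> I" for i
      using M[OF that] infdist_mono[OF CD[of i], of x] z[OF that] by fastforce
    then have xy: "norm (x - y) \<le> \<kappa> * M" using \<kappa>(2)[OF \<open>M \<ge> 0\<close>, of x] y(2) by (metis dist_norm)
    \<comment> \<open>The projection onto \<open>L\<close> is nonexpansive and fixes
      \<open>z\<close>.\<close>
    have yz: "norm (z - y) \<le> norm (x - z)"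
    proof -
      have "closest_point L x = y"
        using closest_point_unique[OF \<open>convex L\<close> \<open>closed L\<close> y(1), of x] y(2) infdist_le[of _ L x]
        by simp
      moreover have "closest_point L z = z" using zL by (rule closest_point_self)
      ultimately show ?thesis
        using closest_point_lipschitz[OF \<open>convex L\<close> \<open>closed L\<close>, of z x] zL
        by (auto simp: dist_norm norm_minus_commute)
    qed
    \<comment> \<open>A bound for the distance from \<open>y\<close> to every non-polyhedral
      \<open>C i\<close>, by way of \<open>x\<close>.\<close>
    define M' where "M' = (1 + \<kappa>) * M"
    have "M' \<ge> 0" using \<open>M \<ge> 0\<close> \<kappa>(1) by (simp add: M'_def)
    \<comment> \<open>Chosen so that \<open>t * \<epsilon> = (1 - t) * M'\<close>: the room of
      radius \<open>\<epsilon>\<close> around \<open>z\<close>, weighted by \<open>t\<close>, makes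
      up for the deviation of \<open>y\<close> from \<open>C i\<close>, weighted by
      \<open>1 - t\<close>.\<close>
    define t where "t = M' / (M' + \<epsilon>)"
    have t: "0 \<le> t" "t \<le> 1" "t \<le> M' / \<epsilon>"
      using \<open>M' \<ge> 0\<close> \<open>\<epsilon> > 0\<close> by (auto simp: t_def field_simps)
    define u where "u = (1 - t) *\<^sub>R y + t *\<^sub>R z"
    have "u \<in> L" unfolding u_def using convexD_alt[OF \<open>convex L\<close> y(1) zL t(1,2)] .
    have "u \<in> C i" if i: "i \<in> I" for i
    proof (cases "polyhedron (C i)")
      case True
      then show ?thesis using \<open>u \<in> L\<close> i by (auto simp: L_def D_def split: if_splits)
    next
      case False
      obtain c where c: "c \<in> C i" "infdist y (C i) = dist y c"
        using infdist_attains_inf[OF cl[OF i]] z[OF i] by blast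
      have "dist y c \<le> infdist x (C i) + dist y x"
        using infdist_triangle[of y "C i" x] c(2) by simp
      also have "\<dots> \<le> M'" using M[OF i] xy by (simp add: M'_def dist_norm norm_minus_commute algebra_simps)
      finally have yc: "norm (y - c) \<le> M'" by (simp add: dist_norm)
      show ?thesis
      proof (cases "M' = 0")
        case True
        \<comment> \<open>Here \<open>y = c\<close> and \<open>t = 0\<close>, so
          \<open>u = c\<close>.\<close>
        then show ?thesis using yc c(1) by (simp add: u_def t_def)
      next
        case False
        then have "M' > 0" using \<open>M' \<ge> 0\<close> by simp
        \<comment> \<open>The offset \<open>y - c\<close> is scaled down to length at most
          \<open>\<epsilon>\<close>, so that adding it to \<open>z\<close> stays in
          \<open>C i\<close>; by \<open>t * s = 1 - t\<close>, the convex combination of this point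
          with \<open>c\<close> is \<open>u\<close>.\<close>
        define s where "s = \<epsilon> / M'"
        have ts: "t * s = 1 - t" using \<open>M' > 0\<close> \<open>\<epsilon> > 0\<close> by (simp add: t_def s_def field_simps)
        have "y \<in> affine hull (C i)" using y(1) i \<open>\<not> polyhedron (C i)\<close> by (auto simp: L_def D_def)
        moreover have "z \<in> affine hull (C i)" "c \<in> affine hull (C i)"
          using z[OF i] c(1) by (auto simp: hull_inc)
        ultimately have "z + s *\<^sub>R (y - c) \<in> affine hull (C i)"
          by (intro mem_affine_3_minus affine_affine_hull)
        moreover have "norm (s *\<^sub>R (y - c)) \<le> \<epsilon>"
          using mult_left_mono[OF yc, of s] \<open>M' > 0\<close> \<open>\<epsilon> > 0\<close> by (simp add: s_def)
        ultimately have "z + s *\<^sub>R (y - c) \<in> C i" using ri[OF i \<open>\<not> polyhedron (C i)\<close>] by simp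
        then have "(1 - t) *\<^sub>R c + t *\<^sub>R (z + s *\<^sub>R (y - c)) \<in> C i"
          by (intro convexD_alt[OF cv[OF i] c(1)] t)
        also have "(1 - t) *\<^sub>R c + t *\<^sub>R (z + s *\<^sub>R (y - c)) = u"
          by (simp add: u_def ts scaleR_add_right) (simp add: algebra_simps)
        finally show ?thesis .
      qed
    qed
    then have "infdist x (\<Inter>i\<in>I. C i) \<le> norm (x - u)"
      using infdist_le[of u "\<Inter>i\<in>I. C i" x] by (simp add: dist_norm)
    also have "\<dots> \<le> norm (x - y) + norm (y - u)" using norm_triangle_ineq[of "x - y" "y - u"] by simp
    also have "y - u = t *\<^sub>R (y - z)" by (simp add: u_def algebra_simps)
    also have "norm (x - y) + norm (t *\<^sub>R (y - z)) \<le> \<kappa> * M + (M' / \<epsilon>) * R"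
    proof (rule add_mono[OF xy])
      have "norm (t *\<^sub>R (y - z)) = t * norm (z - y)" using t(1) by (simp add: norm_minus_commute)
      also have "\<dots> \<le> (M' / \<epsilon>) * R"
        using t yz R(2)[OF \<open>x \<in> U\<close>] \<open>\<epsilon> > 0\<close> \<open>M' \<ge> 0\<close> by (intro mult_mono) auto
      finally show "norm (t *\<^sub>R (y - z)) \<le> (M' / \<epsilon>) * R" .
    qed
    also have "\<dots> \<le> (1 + \<kappa> + (1 + \<kappa>) * R / \<epsilon>) * M"
      using \<open>M \<ge> 0\<close> by (simp add: M'_def algebra_simps)
    finally show ?thesis unfolding M_def .
  qed
  moreover have "1 + \<kappa> + (1 + \<kappa>) * R / \<epsilon> > 0"
    using \<kappa>(1) R(1) \<open>\<epsilon> > 0\<close> by (intro add_pos_nonneg) auto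
  ultimately show ?thesis using that by blast
qed

subsection \<open>Semi-intrepid projections and Fejer monotone sequences\<close>

text \<open>The overshoot past \<open>p\<close> stays on the segment granted by injectability. For
  the descent, the obtuse angle at \<open>p\<close> and an expansion of the square give a decrease
  of at least \<open>(1 - l) * (1 + l) * (norm d)\<^sup>2\<close>, where \<open>d = p - x\<close>,
  \<open>l\<close> is the actual coefficient and
  \<open>norm (y - x) = (1 + l) * norm d\<close>.\<close>

lemma semi_intrepid_proj_props:
  fixes C :: "'a::euclidean_space set"
  assumes inj: "injectable \<tau> C" and "convex C" and \<alpha>: "0 \<le> \<alpha>" "\<alpha> \<le> 1"
    and "y \<in> semi_intrepid_proj C \<alpha> \<tau> x"
  shows semi_intrepid_proj_mem: "y \<in> C"
    and semi_intrepid_proj_descent: "c \<in> C \<Longrightarrow>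
      (norm (y - c))\<^sup>2 \<le> (norm (x - c))\<^sup>2 - (1 - \<alpha>) / (1 + \<alpha>) * (norm (y - x))\<^sup>2"
proof -
  obtain p where p: "p \<in> proj C x" and y: "y = p + min \<alpha> (\<tau> / norm (p - x)) *\<^sub>R (p - x)"
    using assms(5) by (auto simp: semi_intrepid_proj_def)
  have "0 \<le> \<tau>" "closed C" using inj by (auto simp: injectable_def)
  define l where "l = min \<alpha> (\<tau> / norm (p - x))"
  have l: "0 \<le> l" "l \<le> \<alpha>" using \<alpha> \<open>0 \<le> \<tau>\<close> by (auto simp: l_def)
  have seg: "closed_segment p (p + \<tau> *\<^sub>R ((p - x) /\<^sub>R norm (p - x))) \<subseteq> C"
    using inj p by (auto simp: injectable_def)
  have pC: "p \<in> C" using p by (simp add: proj_def)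
  show "y \<in> C"
  proof (cases "p = x \<or> \<tau> = 0")
    case True
    \<comment> \<open>For \<open>p = x\<close> the direction vanishes, for \<open>\<tau> = 0\<close>
      the coefficient.\<close>
    then have "y = p" using \<alpha> by (auto simp: y)
    then show ?thesis using pC by simp
  next
    case False
    then have pos: "norm (p - x) > 0" "\<tau> > 0" using \<open>0 \<le> \<tau>\<close> by auto
    \<comment> \<open>The fraction of the segment covered by the overshoot, whose length
      \<open>l * norm (p - x)\<close> is at most \<open>\<tau>\<close>.\<close>
    define s where "s = l * norm (p - x) / \<tau>"
    have "l * norm (p - x) \<le> \<tau>"
      using pos by (simp add: l_def min_def field_simps split: if_splits)
    then have s: "0 \<le> s" "s \<le> 1" using l(1) pos by (auto simp: s_def)
    have "y = (1 - s) *\<^sub>R p + s *\<^sub>R (p + \<tau> *\<^sub>R ((p - x) /\<^sub>R norm (p - x)))"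
    proof -
      have "s * \<tau> / norm (p - x) = l" using pos by (simp add: s_def)
      then show ?thesis
        using pos by (simp add: y flip: l_def) (simp add: algebra_simps divide_inverse)
    qed
    then have "y \<in> closed_segment p (p + \<tau> *\<^sub>R ((p - x) /\<^sub>R norm (p - x)))"
      using s in_segment(1) by blast
    then show ?thesis using seg by blast
  qed
  assume c: "c \<in> C"
  have "norm (x - p) = infdist x C" using p by (simp add: proj_def)
  then have "\<forall>z\<in>C. dist x p \<le> dist x z" using infdist_le[of _ C x] by (simp add: dist_norm)
  then have dot: "(x - p) \<bullet> (c - p) \<le> 0"
    using any_closest_point_dot[OF \<open>convex C\<close> \<open>closed C\<close> pC c] by blast
  define d where "d = p - x"
  have yd: "y - x = (1 + l) *\<^sub>R d" by (simp add: y d_def l_def algebra_simps)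
  have yc: "y - c = (x - c) + (1 + l) *\<^sub>R d" using yd by (simp add: algebra_simps)
  have "(norm (u + v))\<^sup>2 = (norm u)\<^sup>2 + 2 * (u \<bullet> v) + (norm v)\<^sup>2" for u v :: 'a
    by (simp add: power2_norm_eq_inner inner_add_left inner_add_right inner_commute)
  then have "(norm (y - c))\<^sup>2
      = (norm (x - c))\<^sup>2 + 2 * (1 + l) * (d \<bullet> (x - c)) + (1 + l)\<^sup>2 * (norm d)\<^sup>2"
    unfolding yc using l(1) by (simp add: power_mult_distrib inner_commute)
  moreover have "d \<bullet> (x - c) \<le> - (norm d)\<^sup>2"
  proof -
    have "x - c = - (c - p) - d" by (simp add: d_def)
    then have "d \<bullet> (x - c) = - (d \<bullet> (c - p)) - d \<bullet> d" by (simp add: inner_diff_right)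
    moreover have "d \<bullet> (c - p) \<ge> 0" using dot by (simp add: d_def inner_diff_left)
    ultimately show ?thesis by (simp add: power2_norm_eq_inner)
  qed
  ultimately have "(norm (y - c))\<^sup>2 \<le> (norm (x - c))\<^sup>2 + 2 * (1 + l) * (- (norm d)\<^sup>2) + (1 + l)\<^sup>2 * (norm d)\<^sup>2"
    using l(1) by (smt (verit) mult_left_mono)
  also have "\<dots> = (norm (x - c))\<^sup>2 - (1 - l) / (1 + l) * (norm (y - x))\<^sup>2"
    using l(1) by (simp add: yd power_mult_distrib) (simp add: field_simps power2_eq_square)
  \<comment> \<open>The coefficient \<open>l\<close> may be below \<open>\<alpha>\<close>, but
    \<open>(1 - t) / (1 + t)\<close> decreases in \<open>t\<close>.\<close>
  also have "\<dots> \<le> (norm (x - c))\<^sup>2 - (1 - \<alpha>) / (1 + \<alpha>) * (norm (y - x))\<^sup>2"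
  proof -
    have "(1 - \<alpha>) / (1 + \<alpha>) \<le> (1 - l) / (1 + l)"
      using l \<alpha> by (intro frac_le) auto
    then show ?thesis by (intro diff_left_mono mult_right_mono) auto
  qed
  finally show "(norm (y - c))\<^sup>2 \<le> (norm (x - c))\<^sup>2 - (1 - \<alpha>) / (1 + \<alpha>) * (norm (y - x))\<^sup>2" .
qed

text \<open>All iterates from \<open>x n\<close> on stay in the ball around the point of
  \<open>S\<close> nearest to \<open>x n\<close> with radius \<open>infdist (x n) S\<close>, hence
  within twice that distance of \<open>x n\<close>. This makes the sequence Cauchy, and the bound
  passes to the limit.\<close>

lemma fejer_monotone_convergent:
  fixes x :: "nat \<Rightarrow> 'a::euclidean_space"
  assumes "closed S" "S \<noteq> {}"
    and fejer: "\<And>n k c. c \<in> S \<Longrightarrow> n \<le> k \<Longrightarrow> norm (x k - c) \<le> norm (x n - c)"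
    and lim0: "(\<lambda>n. infdist (x n) S) \<longlonglongrightarrow> 0"
  obtains l where "l \<in> S" "\<And>n. norm (x n - l) \<le> 2 * infdist (x n) S"
proof -
  have near: "norm (x n - x k) \<le> 2 * infdist (x n) S" if "n \<le> k" for n k
  proof -
    obtain c where c: "c \<in> S" "infdist (x n) S = norm (x n - c)"
      using infdist_attains_inf[OF assms(1,2)] by (metis dist_norm)
    have "norm (x n - x k) \<le> norm (x n - c) + norm (x k - c)"
      by (metis norm_triangle_ineq4 diff_diff_eq2 diff_add_cancel add_diff_cancel_right')
    then show ?thesis using fejer[OF c(1) that] c(2) by simp
  qed
  have "Cauchy x"
  proof (rule metric_CauchyI)
    fix e :: real assume "e > 0"
    then have "eventually (\<lambda>n. infdist (x n) S < e / 4) sequentially"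
      by (intro order_tendstoD[OF lim0]) simp
    then obtain N where N: "infdist (x N) S < e / 4" by (auto simp: eventually_sequentially)
    have "dist (x i) (x j) < e" if "N \<le> i" "N \<le> j" for i j
    proof -
      have "dist (x i) (x j) \<le> dist (x N) (x i) + dist (x N) (x j)" by (rule dist_triangle3)
      then show ?thesis using near[OF that(1)] near[OF that(2)] N by (simp add: dist_norm)
    qed
    then show "\<exists>N. \<forall>i\<ge>N. \<forall>j\<ge>N. dist (x i) (x j) < e" by blast
  qed
  then obtain l where l: "x \<longlonglongrightarrow> l" using Cauchy_convergent_iff convergent_def by blast
  have "(\<lambda>n. infdist (x n) S) \<longlonglongrightarrow> infdist l S" by (intro tendsto_infdist l)
  then have "infdist l S = 0" using lim0 LIMSEQ_unique by blast
  then have "l \<in> S" using in_closed_iff_infdist_zero[OF assms(1,2)] by blast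
  moreover have "norm (x n - l) \<le> 2 * infdist (x n) S" for n
  proof (rule LIMSEQ_le_const2)
    show "(\<lambda>k. norm (x n - x k)) \<longlonglongrightarrow> norm (x n - l)" by (intro tendsto_intros l)
    show "\<exists>N. \<forall>k\<ge>N. norm (x n - x k) \<le> 2 * infdist (x n) S" using near by blast
  qed
  ultimately show ?thesis using that by blast
qed

section \<open>Block-wise geometric decay, cyclic index windows and a weighted inequality\<close>

text \<open>With \<open>\<rho> = b powr (1 / (2 * real L))\<close> one has
  \<open>(\<rho> ^ L)\<^sup>2 = b\<close>, so each block shrinks \<open>r\<close> by
  \<open>\<rho> ^ L\<close>. Monotonicity fills in the indices between block ends.\<close>

lemma block_geometric_decay:
  fixes r :: "nat \<Rightarrow> real"
  assumes "decseq r" "\<And>n. 0 \<le> r n" "0 < L" "0 < b" "b < 1"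
    and block: "\<And>k. (r (s + Suc k * L))\<^sup>2 \<le> b * (r (s + k * L))\<^sup>2"
  shows "\<exists>\<sigma>\<ge>0. \<forall>n. r n \<le> \<sigma> * (b powr (1 / (2 * real L))) ^ n"
proof -
  define \<rho> where "\<rho> = b powr (1 / (2 * real L))"
  have \<rho>: "0 < \<rho>" "\<rho> \<le> 1" using assms(4,5) by (auto simp: \<rho>_def powr_le1)
  have "(\<rho> ^ L)\<^sup>2 = b"
  proof -
    have "(\<rho> ^ L)\<^sup>2 = \<rho> powr (real (L * 2))"
      using \<rho>(1) by (simp only: powr_realpow power_mult)
    also have "\<dots> = b" using assms(3,4) by (simp add: \<rho>_def powr_powr)
    finally show ?thesis .
  qed
  have dec: "r j \<le> r i" if "i \<le> j" for i j using assms(1) that by (simp add: decseq_def)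
  have step: "r (s + Suc k * L) \<le> \<rho> ^ L * r (s + k * L)" for k
  proof (rule power2_le_imp_le)
    show "(r (s + Suc k * L))\<^sup>2 \<le> (\<rho> ^ L * r (s + k * L))\<^sup>2"
      using block[of k] \<open>(\<rho> ^ L)\<^sup>2 = b\<close> by (simp add: power_mult_distrib)
    show "0 \<le> \<rho> ^ L * r (s + k * L)" using \<rho> assms(2) by simp
  qed
  have geo: "r (s + k * L) \<le> \<rho> ^ (k * L) * r s" for k
  proof (induction k)
    case (Suc k)
    have "r (s + Suc k * L) \<le> \<rho> ^ L * (\<rho> ^ (k * L) * r s)"
      using step[of k] Suc \<rho> by (smt (verit) mult_left_mono zero_le_power)
    then show ?case by (simp add: power_add mult.assoc)
  qed simp
  have "r n \<le> (r 0 / \<rho> ^ (s + L)) * \<rho> ^ n" for n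
  proof -
    \<comment> \<open>\<open>k\<close> counts the complete blocks from \<open>s\<close> to
      \<open>n\<close>. The offset and the last incomplete block make up at most
      \<open>s + L\<close> indices, paid for by the constant
      \<open>1 / \<rho> ^ (s + L)\<close>.\<close>
    have "\<exists>k. r n \<le> \<rho> ^ (k * L) * r 0 \<and> n \<le> k * L + s + L"
    proof (cases "s \<le> n")
      case True
      define k where "k = (n - s) div L"
      have "k * L \<le> n - s" by (simp add: k_def)
      then have "s + k * L \<le> n" using True by simp
      then have "r n \<le> \<rho> ^ (k * L) * r s" using dec geo[of k] by (meson order_trans)
      also have "\<dots> \<le> \<rho> ^ (k * L) * r 0" using dec[of 0 s] \<rho> by (simp add: mult_left_mono)
      finally have "r n \<le> \<rho> ^ (k * L) * r 0" .
      moreover have "n - s = k * L + (n - s) mod L" by (simp add: k_def)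
      then have "n \<le> k * L + s + L" using True mod_less_divisor[OF assms(3), of "n - s"] by linarith
      ultimately show ?thesis by blast
    next
      case False
      then show ?thesis using dec[of 0 n] by (intro exI[of _ 0]) simp
    qed
    then obtain k where k: "r n \<le> \<rho> ^ (k * L) * r 0" "n \<le> k * L + s + L" by blast
    have "\<rho> ^ (k * L) * \<rho> ^ (s + L) \<le> \<rho> ^ n"
      unfolding power_add[symmetric] using \<rho> k(2) by (intro power_decreasing) auto
    then have "\<rho> ^ (k * L) \<le> \<rho> ^ n / \<rho> ^ (s + L)" using \<rho> by (simp add: pos_le_divide_eq)
    then have "\<rho> ^ (k * L) * r 0 \<le> \<rho> ^ n / \<rho> ^ (s + L) * r 0"
      using assms(2) by (intro mult_right_mono)
    then show ?thesis using k(1) by (simp add: mult.commute)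
  qed
  moreover have "r 0 / \<rho> ^ (s + L) \<ge> 0" using assms(2) \<rho> by simp
  ultimately show ?thesis unfolding \<rho>_def by blast
qed

text \<open>Any \<open>m\<close> consecutive integers are incongruent modulo \<open>m\<close>, which
  gives injectivity and excludes the index of step \<open>n\<close>; counting gives surjectivity.
  Thus the \<open>m - 1\<close> steps after step \<open>n\<close> visit each remaining set exactly
  once.\<close>

lemma cyclic_indices_bij:
  assumes "0 < m"
  shows "bij_betw (\<lambda>k. (Suc n + k) mod m + 1) {..<m - 1} ({1..m} - {n mod m + 1})"
proof -
  have inj: "k = k'" if "k < m" "k' < m" "(n + k) mod m = (n + k') mod m" for k k'
  proof -
    have "int m dvd int k - int k'"
      using that(3) by (metis add_diff_cancel_left mod_eq_dvd_iff of_nat_add of_nat_mod)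
    then show ?thesis
      using dvd_imp_le_int[of "int k - int k'" "int m"] that(1,2) by (cases "k = k'") auto
  qed
  have "inj_on (\<lambda>k. (Suc n + k) mod m + 1) {..<m - 1}"
  proof (rule inj_onI)
    fix k k' assume "k \<in> {..<m - 1}" "k' \<in> {..<m - 1}"
      "(Suc n + k) mod m + 1 = (Suc n + k') mod m + 1"
    then show "k = k'" using inj[of "Suc k" "Suc k'"] by simp
  qed
  moreover have "(\<lambda>k. (Suc n + k) mod m + 1) ` {..<m - 1} = {1..m} - {n mod m + 1}"
  proof (rule card_subset_eq)
    have "(Suc n + k) mod m + 1 \<noteq> n mod m + 1" if "k < m - 1" for k
      using inj[of "Suc k" 0] that assms by (auto simp: less_diff_conv)
    then show "(\<lambda>k. (Suc n + k) mod m + 1) ` {..<m - 1} \<subseteq> {1..m} - {n mod m + 1}"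
      using assms by (auto simp: Suc_le_eq)
    have "card ({1..m} - {n mod m + 1}) = m - 1" using assms by (simp add: Suc_le_eq)
    then show "card ((\<lambda>k. (Suc n + k) mod m + 1) ` {..<m - 1}) = card ({1..m} - {n mod m + 1})"
      using card_image[OF calculation] by simp
  qed simp
  ultimately show ?thesis by (simp add: bij_betw_def)
qed

lemma weighted_Cauchy_Schwarz:
  fixes s q :: "'k \<Rightarrow> real"
  assumes "\<And>k. k \<in> A \<Longrightarrow> q k > 0"
  shows "(\<Sum>k\<in>A. s k)\<^sup>2 \<le> (\<Sum>k\<in>A. q k) * (\<Sum>k\<in>A. (s k)\<^sup>2 / q k)"
proof -
  have "(\<Sum>k\<in>A. s k) = (\<Sum>k\<in>A. sqrt (q k) * (s k / sqrt (q k)))"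
    using assms by (intro sum.cong) (auto simp: less_imp_neq[symmetric])
  also have "\<dots>\<^sup>2 \<le> (\<Sum>k\<in>A. (sqrt (q k))\<^sup>2) * (\<Sum>k\<in>A. (s k / sqrt (q k))\<^sup>2)"
    by (rule Cauchy_Schwarz_ineq_sum)
  also have "\<dots> = (\<Sum>k\<in>A. q k) * (\<Sum>k\<in>A. (s k)\<^sup>2 / q k)"
    using assms by (simp add: power_divide less_imp_le cong: sum.cong)
  finally show ?thesis .
qed

subsection \<open>Cyclic sequences with quadratic descent\<close>

text \<open>Retains from the projections only that each new iterate lies in the set just visited and
  that the squared distance to common points descends; the rates are derived from this.\<close>

locale cyclic_descent =
  fixes m :: nat and C :: "nat \<Rightarrow> 'a::euclidean_space set"
    and \<alpha> :: "nat \<Rightarrow> real" and x :: "nat \<Rightarrow> 'a"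
  assumes m: "2 \<le> m"
    and closed_C: "\<And>i. i \<in> {1..m} \<Longrightarrow> closed (C i)"
    and Int_nonempty: "(\<Inter>i\<in>{1..m}. C i) \<noteq> {}"
    and \<alpha>: "\<And>i. i \<in> {1..m} \<Longrightarrow> \<alpha> i \<in> {0..1}"
    and mem: "\<And>n. x (Suc n) \<in> C (n mod m + 1)"
    and descent: "\<And>n c. c \<in> (\<Inter>i\<in>{1..m}. C i) \<Longrightarrow>
      (norm (x (Suc n) - c))\<^sup>2 \<le> (norm (x n - c))\<^sup>2
        - (1 - \<alpha> (n mod m + 1)) / (1 + \<alpha> (n mod m + 1)) * (norm (x (Suc n) - x n))\<^sup>2"
begin

abbreviation S where "S \<equiv> (\<Inter>i\<in>{1..m}. C i)"

text \<open>The reciprocals of the descent coefficients. For \<open>\<alpha> i = 1\<close> totalised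
  division yields \<open>q i = 0\<close> and makes every quotient by \<open>q i\<close> equal to 0,
  in accord with the vanishing coefficient, so \<open>descent_sum\<close> holds without a case
  distinction.\<close>

abbreviation q where "q \<equiv> (\<lambda>i. (1 + \<alpha> i) / (1 - \<alpha> i))"

lemma index_range: "n mod m + 1 \<in> {1..m}"
  using m mod_less_divisor[of m n] by (auto simp: Suc_le_eq)

lemma closed_S: "closed S"
  using closed_C by blast

lemma fejer_step:
  assumes "c \<in> S"
  shows "norm (x (Suc n) - c) \<le> norm (x n - c)"
proof (rule power2_le_imp_le)
  have "0 \<le> (1 - \<alpha> (n mod m + 1)) / (1 + \<alpha> (n mod m + 1))"
    using \<alpha>[OF index_range[of n]] by simp
  then show "(norm (x (Suc n) - c))\<^sup>2 \<le> (norm (x n - c))\<^sup>2"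
    using descent[OF assms, of n] by (smt (verit) mult_nonneg_nonneg zero_le_power2)
qed simp

lemma fejer:
  assumes "c \<in> S" "n \<le> k"
  shows "norm (x k - c) \<le> norm (x n - c)"
  using assms(2) by (induction rule: dec_induct) (use fejer_step[OF assms(1)] order_trans in blast)+

lemma decseq_infdist: "decseq (\<lambda>n. infdist (x n) S)"
proof (rule decseq_SucI)
  fix n
  obtain c where "c \<in> S" "infdist (x n) S = norm (x n - c)"
    using infdist_attains_inf[OF closed_S Int_nonempty] by (metis dist_norm)
  then show "infdist (x (Suc n)) S \<le> infdist (x n) S"
    using fejer_step[of c n] infdist_le[of c S "x (Suc n)"] by (simp add: dist_norm)
qed

lemma descent_sum:
  assumes "c \<in> S"
  shows "(\<Sum>k<K. (norm (x (Suc (n + k)) - x (n + k)))\<^sup>2 / q ((n + k) mod m + 1))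
    \<le> (norm (x n - c))\<^sup>2 - (norm (x (n + K) - c))\<^sup>2"
proof (induction K)
  case (Suc K)
  then show ?case using descent[OF assms, of "n + K"] by (simp add: mult.commute)
qed simp

text \<open>Write \<open>D\<close> for the distance to \<open>S\<close> at the start of the block
  and \<open>d'\<close> at its end. Path length, regularity, weighted Cauchy-Schwarz and telescoped
  descent combine to \<open>D\<^sup>2 \<le> \<kappa>\<^sup>2 * Q * (D\<^sup>2 - d'\<^sup>2)\<close>,
  which is solved for \<open>d'\<^sup>2\<close>. An upper bound \<open>Q\<close> in place of the
  exact sum permits one constant for all starting sets.\<close>

lemma block_contraction:
  assumes "\<kappa> > 0"
    and reg: "infdist (x (Suc n)) S \<le> \<kappa> * Max ((\<lambda>i. infdist (x (Suc n)) (C i)) ` {1..m})"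
    and lt1: "\<And>i. i \<in> {1..m} - {n mod m + 1} \<Longrightarrow> \<alpha> i < 1"
    and Q: "(\<Sum>i\<in>{1..m} - {n mod m + 1}. q i) \<le> Q"
  shows "(infdist (x (Suc n + (m - 1))) S)\<^sup>2
      \<le> (1 - 1 / \<kappa>\<^sup>2 * inverse Q) * (infdist (x (Suc n)) S)\<^sup>2"
    and "Q > 0"
proof -
  define y where "y = x (Suc n)"
  define s where "s k = norm (x (Suc (Suc n + k)) - x (Suc n + k))" for k
  define ix where "ix k = (Suc n + k) mod m + 1" for k
  have bij: "bij_betw ix {..<m - 1} ({1..m} - {n mod m + 1})"
    unfolding ix_def using cyclic_indices_bij[of m n] m by simp
  have qpos: "q i > 0" if "i \<in> {1..m} - {n mod m + 1}" for i
  proof -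
    have "0 \<le> \<alpha> i" using \<alpha>[of i] that by simp
    then show ?thesis using lt1[OF that] by simp
  qed
  have qix: "q (ix k) > 0" if "k < m - 1" for k
    using qpos bij_betwE[OF bij] that by blast
  have sumq: "(\<Sum>k<m - 1. q (ix k)) = (\<Sum>i\<in>{1..m} - {n mod m + 1}. q i)"
    using sum.reindex_bij_betw[OF bij, of q] by simp
  have "(\<Sum>k<m - 1. q (ix k)) > 0"
    using qix m by (intro sum_pos) (auto simp: lessThan_empty_iff)
  then show "Q > 0" using Q sumq by linarith
  obtain c where c: "c \<in> S" "infdist y S = norm (y - c)"
    using infdist_attains_inf[OF closed_S Int_nonempty] by (metis dist_norm)
  define d' where "d' = infdist (x (Suc n + (m - 1))) S"
  have d': "d' \<le> norm (x (Suc n + (m - 1)) - c)" "0 \<le> d'"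
    using infdist_le[OF c(1)] by (simp_all add: d'_def dist_norm infdist_nonneg)
  have path: "norm (y - x (Suc n + K)) \<le> (\<Sum>k<K. s k)" for K
  proof (induction K)
    case (Suc K)
    have "norm (y - x (Suc n + Suc K)) \<le> norm (y - x (Suc n + K)) + s K"
      using norm_triangle_ineq[of "y - x (Suc n + K)" "x (Suc n + K) - x (Suc n + Suc K)"]
      by (simp add: s_def norm_minus_commute)
    then show ?case using Suc by simp
  qed (simp add: y_def)
  have "infdist y (C i) \<le> (\<Sum>k<m - 1. s k)" if i: "i \<in> {1..m}" for i
  proof (cases "i = n mod m + 1")
    case True
    then have "infdist y (C i) = 0" using mem[of n] by (simp add: y_def)
    then show ?thesis by (simp add: sum_nonneg s_def)
  next
    case False
    then have "i \<in> ix ` {..<m - 1}" using i unfolding bij_betw_imp_surj_on[OF bij] by simp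
    then obtain k where k: "k < m - 1" "ix k = i" by blast
    have "infdist y (C i) \<le> norm (y - x (Suc n + Suc k))"
      using mem[of "Suc n + k"] infdist_le[of _ "C i" y] k(2) by (simp add: ix_def dist_norm)
    also have "\<dots> \<le> (\<Sum>k<Suc k. s k)" by (rule path)
    also have "\<dots> \<le> (\<Sum>k<m - 1. s k)" using k(1) by (intro sum_mono2) (auto simp: s_def)
    finally show ?thesis .
  qed
  then have "Max ((\<lambda>i. infdist y (C i)) ` {1..m}) \<le> (\<Sum>k<m - 1. s k)"
    using m by (intro Max.boundedI) auto
  then have "infdist y S \<le> \<kappa> * (\<Sum>k<m - 1. s k)"
    using reg \<open>\<kappa> > 0\<close> unfolding y_def by (meson less_imp_le mult_left_mono order_trans)
  then have "(infdist y S)\<^sup>2 \<le> (\<kappa> * (\<Sum>k<m - 1. s k))\<^sup>2"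
    by (intro power_mono) (auto simp: infdist_nonneg)
  also have "\<dots> \<le> \<kappa>\<^sup>2 * ((\<Sum>k<m - 1. q (ix k)) * (\<Sum>k<m - 1. (s k)\<^sup>2 / q (ix k)))"
    unfolding power_mult_distrib
    by (intro mult_left_mono weighted_Cauchy_Schwarz qix) auto
  also have "\<dots> \<le> \<kappa>\<^sup>2 * (Q * ((infdist y S)\<^sup>2 - d'\<^sup>2))"
  proof (intro mult_left_mono mult_mono)
    \<comment> \<open>Descent is measured toward the point \<open>c\<close> of \<open>S\<close>
      nearest to \<open>y\<close>: its distance is exact at the start and only an upper bound for
      \<open>d'\<close> at the end.\<close>
    have "(\<Sum>k<m - 1. (s k)\<^sup>2 / q (ix k)) \<le> (norm (y - c))\<^sup>2 - (norm (x (Suc n + (m - 1)) - c))\<^sup>2"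
      using descent_sum[OF c(1), where n = "Suc n" and K = "m - 1"]
      unfolding s_def ix_def y_def .
    moreover have "d'\<^sup>2 \<le> (norm (x (Suc n + (m - 1)) - c))\<^sup>2" using d' by (intro power_mono)
    ultimately show "(\<Sum>k<m - 1. (s k)\<^sup>2 / q (ix k)) \<le> (infdist y S)\<^sup>2 - d'\<^sup>2"
      using c(2) by simp
    show "0 \<le> (\<Sum>k<m - 1. (s k)\<^sup>2 / q (ix k))"
      using qix by (intro sum_nonneg divide_nonneg_pos) auto
  qed (use sumq Q \<open>Q > 0\<close> in auto)
  finally show "d'\<^sup>2 \<le> (1 - 1 / \<kappa>\<^sup>2 * inverse Q) * (infdist y S)\<^sup>2"
    using \<open>Q > 0\<close> \<open>\<kappa> > 0\<close> by (simp add: field_simps)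
qed

text \<open>Blocks advance by \<open>L = m - 1 + card J\<close>: by \<open>m - 1\<close> if
  \<open>J\<close> is empty, where any iterate after the first step may start a block, and by
  \<open>m\<close> if \<open>J = {j}\<close>, where each block starts right after the step onto
  \<open>C j\<close>. The bound after only \<open>m - 1\<close> steps serves the count in the finite
  termination case.\<close>

lemma infdist_block_decay:
  assumes J1: "card {i \<in> {1..m}. \<alpha> i = 1} \<le> 1"
    and "regularity_modulus_for_start {1..m} C (x 0) \<kappa>"
  obtains b L s where "b < 1" "m - 1 \<le> L" "s \<le> m"
    "semi_intrepid_rate m \<alpha> \<kappa> = max 0 b powr (1 / (2 * real L))"
    "\<And>k. (infdist (x (s + k * L + (m - 1))) S)\<^sup>2 \<le> b * (infdist (x (s + k * L)) S)\<^sup>2"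
    "\<And>k. (infdist (x (s + Suc k * L)) S)\<^sup>2 \<le> b * (infdist (x (s + k * L)) S)\<^sup>2"
proof -
  define J where "J = {i \<in> {1..m}. \<alpha> i = 1}"
  have finJ: "finite J" by (simp add: J_def)
  define Q where "Q = (\<Sum>i\<in>{1..m} - J. q i) - (1 - real (card J)) * Min (q ` ({1..m} - J))"
  define b where "b = 1 - 1 / \<kappa>\<^sup>2 * inverse Q"
  define L where "L = m - 1 + card J"
  obtain \<delta> w where w: "w \<in> S" "2 * norm (x 0 - w) \<le> \<delta>" and
    reg: "linear_regularity_modulus {1..m} C (cball w (\<delta> / 2)) \<kappa>"
    using assms(2) unfolding regularity_modulus_for_start_def by blast
  have "\<kappa> > 0" using reg by (simp add: linear_regularity_modulus_def)
  \<comment> \<open>By Fejer monotonicity the iterates never leave the ball around \<open>w\<close>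
    on which \<open>\<kappa>\<close> is valid.\<close>
  have regx: "infdist (x n) S \<le> \<kappa> * Max ((\<lambda>i. infdist (x n) (C i)) ` {1..m})" for n
  proof -
    have "dist w (x n) \<le> \<delta> / 2"
      using fejer[OF w(1), of 0 n] w(2) by (simp add: dist_norm norm_minus_commute)
    then show ?thesis using reg by (simp add: linear_regularity_modulus_def)
  qed
  have lt1: "\<alpha> i < 1" if "i \<in> {1..m} - J" for i
    using \<alpha>[of i] that by (auto simp: J_def less_le)
  have block: "(infdist (x (Suc n + (m - 1))) S)\<^sup>2 \<le> b * (infdist (x (Suc n)) S)\<^sup>2 \<and> Q > 0"
    if "J \<subseteq> {n mod m + 1}" for n
  proof -
    let ?i = "n mod m + 1"
    have sub: "{1..m} - {?i} \<subseteq> {1..m} - J" using that by blast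
    have "(\<Sum>i\<in>{1..m} - {?i}. q i) \<le> Q"
    proof (cases "J = {}")
      case True
      \<comment> \<open>The sum omits \<open>q ?i\<close>, which is at least the minimum subtracted
        in \<open>Q\<close>; so \<open>Q\<close> bounds it for every starting set.\<close>
      have "Min (q ` {1..m}) \<le> q ?i" using index_range[of n] by (intro Min_le) auto
      then show ?thesis using index_range[of n] True by (simp add: Q_def sum_diff1)
    next
      case False
      then have "J = {?i}" using that by blast
      then show ?thesis by (simp add: Q_def)
    qed
    then show ?thesis
      using block_contraction[OF \<open>\<kappa> > 0\<close> regx] lt1 sub unfolding b_def by blast
  qed
  \<comment> \<open>The offset is 1 if \<open>J\<close> is empty, as \<open>x 1\<close> is the first
    iterate known to lie in one of the sets, and \<open>j\<close> if \<open>J = {j}\<close>, as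
    \<open>x j\<close> results from the step onto \<open>C j\<close>.\<close>
  obtain s where s: "s \<le> m" "\<And>k. \<exists>n. s + k * L = Suc n \<and> J \<subseteq> {n mod m + 1}"
  proof (cases "J = {}")
    case True
    then show ?thesis using that[of 1] m by simp
  next
    case False
    then have "card J = 1" using J1 finJ card_0_eq[of J] unfolding J_def[symmetric] by linarith
    then obtain j where J: "J = {j}" by (auto simp: card_1_singleton_iff)
    then have j: "1 \<le> j" "j \<le> m" by (auto simp: J_def)
    have "L = m" using \<open>card J = 1\<close> m by (simp add: L_def)
    have "(j - 1 + k * m) mod m = j - 1" for k using j by (subst mod_mult_self1) simp
    then have "j + k * L = Suc (j - 1 + k * m) \<and> J \<subseteq> {(j - 1 + k * m) mod m + 1}" for k
      using j J \<open>L = m\<close> by (auto simp del: mod_mult_self1)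
    then show ?thesis using that[of j] j(2) by blast
  qed
  have bl: "(infdist (x (s + k * L + (m - 1))) S)\<^sup>2 \<le> b * (infdist (x (s + k * L)) S)\<^sup>2" for k
    using s(2)[of k] block by metis
  have "Q > 0" using s(2)[of 0] block by blast
  then have "b < 1" using \<open>\<kappa> > 0\<close> by (simp add: b_def)
  moreover have "semi_intrepid_rate m \<alpha> \<kappa> = max 0 b powr (1 / (2 * real L))"
  proof -
    have "real L = real m - 1 + real (card J)" using m by (simp add: L_def of_nat_diff)
    then show ?thesis
      unfolding semi_intrepid_rate_def Let_def J_def[symmetric] Q_def[symmetric] b_def by simp
  qed
  moreover have "(infdist (x (s + Suc k * L)) S)\<^sup>2 \<le> b * (infdist (x (s + k * L)) S)\<^sup>2" for k
  proof -
    have "infdist (x (s + Suc k * L)) S \<le> infdist (x (s + k * L + (m - 1))) S"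
      by (rule decseqD[OF decseq_infdist]) (simp add: L_def)
    then show ?thesis using bl[of k] by (meson infdist_nonneg order_trans power_mono)
  qed
  ultimately show ?thesis using that[of b L s] s(1) bl by (simp add: L_def)
qed

text \<open>The contraction factor \<open>b\<close> of the blocks may be nonpositive. If it is
  positive, it gives the stated rate; if not, one block already reaches \<open>S\<close>. Raising it
  to a positive factor yields some geometric rate in either case.\<close>

lemma infdist_linear_decay:
  assumes "card {i \<in> {1..m}. \<alpha> i = 1} \<le> 1"
    and "regularity_modulus_for_start {1..m} C (x 0) \<kappa>"
  shows "\<exists>\<rho>>0. \<rho> < 1 \<and> (\<exists>\<sigma>\<ge>0. \<forall>n. infdist (x n) S \<le> \<sigma> * \<rho> ^ n)"
    and "semi_intrepid_rate m \<alpha> \<kappa> > 0 \<Longrightarrow> semi_intrepid_rate m \<alpha> \<kappa> < 1 \<and>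
      (\<exists>\<sigma>\<ge>0. \<forall>n. infdist (x n) S \<le> \<sigma> * semi_intrepid_rate m \<alpha> \<kappa> ^ n)"
    and "\<not> semi_intrepid_rate m \<alpha> \<kappa> > 0 \<Longrightarrow> 2 * m - 1 \<le> n \<Longrightarrow> infdist (x n) S = 0"
proof -
  obtain b L s where b: "b < 1" and L: "m - 1 \<le> L" and "s \<le> m" and
    rate: "semi_intrepid_rate m \<alpha> \<kappa> = max 0 b powr (1 / (2 * real L))" and
    bl1: "\<And>k. (infdist (x (s + k * L + (m - 1))) S)\<^sup>2 \<le> b * (infdist (x (s + k * L)) S)\<^sup>2" and
    bl: "\<And>k. (infdist (x (s + Suc k * L)) S)\<^sup>2 \<le> b * (infdist (x (s + k * L)) S)\<^sup>2"
    using infdist_block_decay[OF assms] by metis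
  have "L > 0" using L m by simp
  have decay: "b' powr (1 / (2 * real L)) < 1 \<and>
      (\<exists>\<sigma>\<ge>0. \<forall>n. infdist (x n) S \<le> \<sigma> * (b' powr (1 / (2 * real L))) ^ n)"
    if "0 < b'" "b' < 1" "b \<le> b'" for b'
  proof (intro conjI block_geometric_decay[where s = s])
    show "b' powr (1 / (2 * real L)) < 1"
      using powr_less_mono2[of "1 / (2 * real L)" b' 1] that \<open>L > 0\<close> by simp
    show "(infdist (x (s + Suc k * L)) S)\<^sup>2 \<le> b' * (infdist (x (s + k * L)) S)\<^sup>2" for k
      using bl[of k] mult_right_mono[OF \<open>b \<le> b'\<close>, of "(infdist (x (s + k * L)) S)\<^sup>2"] by simp
  qed (use that \<open>L > 0\<close> decseq_infdist infdist_nonneg in auto)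
  show "\<exists>\<rho>>0. \<rho> < 1 \<and> (\<exists>\<sigma>\<ge>0. \<forall>n. infdist (x n) S \<le> \<sigma> * \<rho> ^ n)"
  proof -
    \<comment> \<open>Any number strictly between 0 and 1 could replace \<open>1 / 2\<close>; it
      covers \<open>b \<le> 0\<close>.\<close>
    let ?b = "max (1 / 2) b"
    have "0 < ?b powr (1 / (2 * real L))" by (simp add: max_def)
    then show ?thesis using decay[of ?b] b by (intro exI[of _ "?b powr (1 / (2 * real L))"]) auto
  qed
  show "semi_intrepid_rate m \<alpha> \<kappa> < 1 \<and>
      (\<exists>\<sigma>\<ge>0. \<forall>n. infdist (x n) S \<le> \<sigma> * semi_intrepid_rate m \<alpha> \<kappa> ^ n)"
    if "semi_intrepid_rate m \<alpha> \<kappa> > 0"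
  proof -
    have "b > 0" using that unfolding rate by (auto simp: max_def split: if_splits)
    then show ?thesis using decay[of b] b unfolding rate by simp
  qed
  show "infdist (x n) S = 0" if "\<not> semi_intrepid_rate m \<alpha> \<kappa> > 0" "2 * m - 1 \<le> n"
  proof -
    have "b \<le> 0" using that(1) unfolding rate by (auto simp: max_def split: if_splits)
    have "(infdist (x (s + (m - 1))) S)\<^sup>2 \<le> b * (infdist (x s) S)\<^sup>2"
      using bl1[of 0] by simp
    also have "\<dots> \<le> 0" using \<open>b \<le> 0\<close> by (intro mult_nonpos_nonneg) auto
    finally have "infdist (x (s + (m - 1))) S = 0" by simp
    \<comment> \<open>The first block ends at index \<open>s + (m - 1)\<close>, and
      \<open>s \<le> m\<close> gives the threshold \<open>2 * m - 1\<close>.\<close>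
    moreover have "infdist (x n) S \<le> infdist (x (s + (m - 1))) S"
      using \<open>s \<le> m\<close> that(2) by (intro decseqD[OF decseq_infdist]) simp
    ultimately show ?thesis using infdist_nonneg[of "x n" S] by simp
  qed
qed

theorem linear_convergence:
  assumes J1: "card {i \<in> {1..m}. \<alpha> i = 1} \<le> 1"
    and "regularity_modulus_for_start {1..m} C (x 0) \<kappa>\<^sub>0"
  shows "\<exists>l\<in>S. R_linearly_convergent x l \<and>
    (\<forall>\<kappa>. regularity_modulus_for_start {1..m} C (x 0) \<kappa> \<longrightarrow>
      (if semi_intrepid_rate m \<alpha> \<kappa> > 0
       then R_linear_rate x l (semi_intrepid_rate m \<alpha> \<kappa>)
       else (\<forall>n \<ge> 2 * m - 1. x n = l)))"
proof -
  obtain \<rho> \<sigma> where \<rho>: "0 < \<rho>" "\<rho> < 1" "\<And>n. infdist (x n) S \<le> \<sigma> * \<rho> ^ n"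
    using infdist_linear_decay(1)[OF assms] by blast
  have "(\<lambda>n. infdist (x n) S) \<longlonglongrightarrow> 0"
  proof (rule tendsto_sandwich[OF _ _ tendsto_const])
    show "(\<lambda>n. \<sigma> * \<rho> ^ n) \<longlonglongrightarrow> 0"
      using \<rho>(1,2) by (intro tendsto_mult_right_zero LIMSEQ_power_zero) simp
  qed (use \<rho>(3) in \<open>auto intro: always_eventually simp: infdist_nonneg\<close>)
  \<comment> \<open>The limit is fixed before any particular \<open>\<kappa>\<close> is considered,
    so one \<open>l\<close> serves all moduli.\<close>
  then obtain l where l: "l \<in> S" "\<And>n. norm (x n - l) \<le> 2 * infdist (x n) S"
    using fejer_monotone_convergent[OF closed_S Int_nonempty, of x] fejer by blast
  have rate: "R_linear_rate x l r"
    if r: "0 < r" "r < 1" "\<exists>\<sigma>\<ge>0. \<forall>n. infdist (x n) S \<le> \<sigma> * r ^ n" for r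
  proof -
    obtain \<sigma> where \<sigma>: "\<sigma> \<ge> 0" "\<And>n. infdist (x n) S \<le> \<sigma> * r ^ n" using r(3) by blast
    have "norm (x n - l) \<le> (2 * \<sigma>) * r ^ n" for n using l(2)[of n] \<sigma>(2)[of n] by simp
    moreover have "0 \<le> 2 * \<sigma>" using \<sigma>(1) by simp
    ultimately show ?thesis using r(1,2) unfolding R_linear_rate_def by (meson less_imp_le)
  qed
  have "R_linearly_convergent x l"
    using infdist_linear_decay(1)[OF assms] rate unfolding R_linearly_convergent_def by blast
  moreover have "if semi_intrepid_rate m \<alpha> \<kappa> > 0
       then R_linear_rate x l (semi_intrepid_rate m \<alpha> \<kappa>)
       else (\<forall>n \<ge> 2 * m - 1. x n = l)"
    if \<kappa>: "regularity_modulus_for_start {1..m} C (x 0) \<kappa>" for \<kappa>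
  proof (cases "semi_intrepid_rate m \<alpha> \<kappa> > 0")
    case True
    then show ?thesis using infdist_linear_decay(2)[OF J1 \<kappa>] rate by simp
  next
    case False
    then have "x n = l" if "2 * m - 1 \<le> n" for n
      using infdist_linear_decay(3)[OF J1 \<kappa> False that] l(2)[of n] by simp
    then show ?thesis using False by simp
  qed
  ultimately show ?thesis using l(1) by blast
qed

end

section \<open>Convergence of cyclic semi-intrepid projections\<close>

text \<open>Bounded linear regularity supplies a modulus for every starting point, and every
  sequence in question is an instance of \<open>cyclic_descent\<close>. In the \<open>else\<close>
  branch the rate value is 0, and the claim is exact arrival at \<open>l\<close> by index
  \<open>2 * m - 1\<close>.\<close>

theorem corollary5p20:
  fixes m :: nat
    and C :: "nat \<Rightarrow> 'a::euclidean_space set"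
    and \<tau> \<alpha> :: "nat \<Rightarrow> real"
  defines "I \<equiv> {1..m}"
  defines "Ip \<equiv> {i \<in> I. polyhedron (C i)}"
  assumes "2 \<le> m"
    and "\<And>i. i \<in> I \<Longrightarrow> closed (C i)"
    and "\<And>i. i \<in> I \<Longrightarrow> convex (C i)"
    and "(\<Inter>i\<in>Ip. C i) \<inter> (\<Inter>i\<in>I - Ip. rel_interior (C i)) \<noteq> {}"
    and "\<And>i. i \<in> I \<Longrightarrow> injectable (\<tau> i) (C i)"
    and "\<And>i. i \<in> I \<Longrightarrow> \<alpha> i \<in> {0..1}"
    and "card {i \<in> I. \<alpha> i = 1} \<le> 1"
  shows "(\<forall>x. cyclic_sequence m (\<lambda>i. semi_intrepid_proj (C i) (\<alpha> i) (\<tau> i)) x \<longrightarrow>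
            (\<exists>l \<in> (\<Inter>i\<in>I. C i).
               R_linearly_convergent x l \<and>
               (\<forall>\<kappa>. regularity_modulus_for_start I C (x 0) \<kappa> \<longrightarrow>
                  (if semi_intrepid_rate m \<alpha> \<kappa> > 0
                   then R_linear_rate x l (semi_intrepid_rate m \<alpha> \<kappa>)
                   else (\<forall>n \<ge> 2 * m - 1. x n = l)))))
         \<and> (\<forall>x0. \<exists>\<kappa>. regularity_modulus_for_start I C x0 \<kappa>)"
proof -
  obtain z where z: "\<And>i. i \<in> Ip \<Longrightarrow> z \<in> C i" "\<And>i. i \<in> I - Ip \<Longrightarrow> z \<in> rel_interior (C i)"
    using assms(6) by blast
  have z_mem: "z \<in> C i" if "i \<in> I" for i
    using z that rel_interior_subset[of "C i"] by (cases "i \<in> Ip") auto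
  have "finite I" "I \<noteq> {}" using assms(3) by (auto simp: I_def)
  have modulus: "\<exists>\<kappa>. regularity_modulus_for_start I C x0 \<kappa>" for x0
  proof -
    \<comment> \<open>Large enough for both lower bounds on \<open>\<delta>\<close> with
      \<open>w = z\<close>; the summand 1 keeps it positive when \<open>x0 = z\<close>.\<close>
    define \<delta> where "\<delta> = 2 * norm (x0 - z) + 1"
    obtain \<kappa> where "\<kappa> > 0" "\<And>x. x \<in> cball z (\<delta> / 2) \<Longrightarrow>
        infdist x (\<Inter>i\<in>I. C i) \<le> \<kappa> * Max ((\<lambda>i. infdist x (C i)) ` I)"
      by (rule boundedly_linearly_regular[OF \<open>finite I\<close> \<open>I \<noteq> {}\<close> assms(4,5) z_mem,
            where U = "cball z (\<delta> / 2)"])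
        (use z(2) in \<open>auto simp: Ip_def\<close>)
    then have "linear_regularity_modulus I C (cball z (\<delta> / 2)) \<kappa>"
      by (simp add: linear_regularity_modulus_def)
    moreover have "infdist x0 (\<Inter>i\<in>I. C i) \<le> norm (x0 - z)"
      using infdist_le[of z "\<Inter>i\<in>I. C i" x0] z_mem by (simp add: dist_norm)
    ultimately show ?thesis
      unfolding regularity_modulus_for_start_def using z_mem
      by (intro exI[of _ \<kappa>] exI[of _ \<delta>] exI[of _ z]) (auto simp: \<delta>_def intro: add_nonneg_pos)
  qed
  moreover have "\<exists>l \<in> (\<Inter>i\<in>I. C i).
               R_linearly_convergent x l \<and>
               (\<forall>\<kappa>. regularity_modulus_for_start I C (x 0) \<kappa> \<longrightarrow>
                  (if semi_intrepid_rate m \<alpha> \<kappa> > 0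
                   then R_linear_rate x l (semi_intrepid_rate m \<alpha> \<kappa>)
                   else (\<forall>n \<ge> 2 * m - 1. x n = l)))"
    if x: "cyclic_sequence m (\<lambda>i. semi_intrepid_proj (C i) (\<alpha> i) (\<tau> i)) x" for x
  proof -
    have step: "x (Suc n) \<in> semi_intrepid_proj (C i) (\<alpha> i) (\<tau> i) (x n)" "i \<in> I"
      if "i = n mod m + 1" for n i
      using x assms(3) mod_less_divisor[of m n] that
      by (auto simp: cyclic_sequence_def I_def Suc_le_eq)
    interpret cyclic_descent m C \<alpha> x
    proof
      show "(\<Inter>i\<in>{1..m}. C i) \<noteq> {}" using z_mem unfolding I_def by blast
      fix n
      let ?i = "n mod m + 1"
      have "0 \<le> \<alpha> ?i" "\<alpha> ?i \<le> 1" using assms(8)[OF step(2)[OF refl]] by auto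
      note props = semi_intrepid_proj_props[OF assms(7)[OF step(2)[OF refl]]
          assms(5)[OF step(2)[OF refl]] this step(1)[OF refl]]
      show "x (Suc n) \<in> C ?i" by (rule props(1))
      fix c assume "c \<in> (\<Inter>i\<in>{1..m}. C i)"
      then have "c \<in> C ?i" using step(2)[of ?i n] by (auto simp: I_def)
      then show "(norm (x (Suc n) - c))\<^sup>2 \<le> (norm (x n - c))\<^sup>2
          - (1 - \<alpha> ?i) / (1 + \<alpha> ?i) * (norm (x (Suc n) - x n))\<^sup>2"
        by (rule props(2))
    qed (use assms(3,4,8) in \<open>auto simp: I_def\<close>)
    obtain \<kappa>\<^sub>0 where "regularity_modulus_for_start I C (x 0) \<kappa>\<^sub>0" using modulus by blast
    then show ?thesis using linear_convergence assms(9) unfolding I_def by blast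
  qed
  ultimately show ?thesis by blast
qed

end
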